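(* Let $X$ be a Hausdorff space and let $G$ be a finite germ extension of some $B\leq\mathrm{Homeo}(X)$. Suppose that $B$ is simple, locally moving, and has no global fixed points in $X$, and that $B$ and $G$ have the same orbits in $X$. Then the commutator subgroup $G'$ is simple, and every proper quotient of $G$ is abelian.
   Context: Finite germ extensions. Let $X$ be a Hausdorff space and $B\leq\mathrm{Homeo}(X)$ a group of homeomorphisms of $X$ (the base group). For $h\in\mathrm{Homeo}(X)$, $\mathrm{sing}(h)$ is the set of points $p\in X$ such that $h$ does not agree with any element of $B$ on any neighborhood of $p$. A group $G\leq\mathrm{Homeo}(X)$ is a finite germ extension of $B$ if: (i) $\mathrm{sing}(g)$ is finite for every $g\in G$; (ii) $B\leq G$, and $B$ is precisely the set of $g\in G$ with $\mathrm{sing}(g)=\emptyset$; (iii) for every $g\in G$ and $p\in\mathrm{sing}(g)$ there is an $h\in G$ with $\mathrm{sing}(h)=\{p\}$ such that $h$ agrees with $g$ on some neighborhood of $p$. $B$ is locally moving if for each nonempty open set $U\subseteq X$ there is a nontrivial element of $B$ which is supported on $U$ (i.e. is the identity on $X\setminus U$). A proper quotient of $G$ is a quotient by a nontrivial normal subgroup. *)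

theory Defs
  imports
    "HOL-Analysis.Analysis"
    "HOL-Combinatorics.Permutations"
    "HOL-Algebra.Coset"
    "HOL-Algebra.Generated_Groups"
    "HOL-Algebra.Group_Action"
begin

text \<open>A homeomorphism of \<open>X\<close> is represented by the total function that is the identity off
  \<open>topspace X\<close> (the convention of \<open>permutes\<close>), so that distinct elements of the carrier are
  distinct homeomorphisms and the group operations are plain \<open>(\<circ>)\<close> and \<open>id\<close>.\<close>

definition Homeo :: "'a topology \<Rightarrow> ('a \<Rightarrow> 'a) monoid" where
  "Homeo X = \<lparr> carrier = {f. f permutes topspace X \<and> homeomorphic_map X X f},
               mult = (\<circ>), one = id \<rparr>"

abbreviation subgrp :: "'a topology \<Rightarrow> ('a \<Rightarrow> 'a) set \<Rightarrow> ('a \<Rightarrow> 'a) monoid" where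
  "subgrp X H \<equiv> (Homeo X) \<lparr> carrier := H \<rparr>"

definition agree_near :: "'a topology \<Rightarrow> 'a \<Rightarrow> ('a \<Rightarrow> 'a) \<Rightarrow> ('a \<Rightarrow> 'a) \<Rightarrow> bool" where
  "agree_near X p f g \<longleftrightarrow> (\<exists>U. openin X U \<and> p \<in> U \<and> (\<forall>x\<in>U. f x = g x))"

definition sing :: "'a topology \<Rightarrow> ('a \<Rightarrow> 'a) set \<Rightarrow> ('a \<Rightarrow> 'a) \<Rightarrow> 'a set" where
  "sing X B h = {p \<in> topspace X. \<not> (\<exists>b\<in>B. agree_near X p h b)}"

definition finite_germ_extension ::
  "'a topology \<Rightarrow> ('a \<Rightarrow> 'a) set \<Rightarrow> ('a \<Rightarrow> 'a) set \<Rightarrow> bool" where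
  "finite_germ_extension X B G \<longleftrightarrow>
     subgroup B (Homeo X) \<and> subgroup G (Homeo X) \<and>
     (\<forall>g\<in>G. finite (sing X B g)) \<and>
     B \<subseteq> G \<and> B = {g \<in> G. sing X B g = {}} \<and>
     (\<forall>g\<in>G. \<forall>p\<in>sing X B g. \<exists>h\<in>G. sing X B h = {p} \<and> agree_near X p h g)"

definition locally_moving :: "'a topology \<Rightarrow> ('a \<Rightarrow> 'a) set \<Rightarrow> bool" where
  "locally_moving X B \<longleftrightarrow>
     (\<forall>U. openin X U \<and> U \<noteq> {} \<longrightarrow>
        (\<exists>b\<in>B. b \<noteq> id \<and> (\<forall>x\<in>topspace X - U. b x = x)))"

text \<open>The locale \<open>simple_group\<close> of \<open>HOL-Algebra\<close> requires \<open>order G > 1\<close>, where \<open>order\<close> is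
  \<open>card\<close> of the carrier and hence 0 for infinite groups; it only covers finite simple groups.\<close>

definition is_simple :: "('g, 'm) monoid_scheme \<Rightarrow> bool" where
  "is_simple G \<longleftrightarrow> group G \<and> carrier G \<noteq> {\<one>\<^bsub>G\<^esub>} \<and>
     (\<forall>N. N \<lhd> G \<longrightarrow> N = {\<one>\<^bsub>G\<^esub>} \<or> N = carrier G)"

lemma group_Homeo: "group (Homeo X)"
proof (rule groupI)
  fix f assume "f \<in> carrier (Homeo X)"
  then have f: "f permutes topspace X" "homeomorphic_map X X f"
    by (auto simp: Homeo_def)
  have i: "inv_into UNIV f permutes topspace X"
    using f(1) by (rule permutes_inv)
  obtain g where g: "homeomorphic_maps X X f g"
    using f(2) by (auto simp: homeomorphic_map_maps)
  have "g x = inv_into UNIV f x" if "x \<in> topspace X" for x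
    using g that permutes_inverses(1)[OF f(1)] permutes_in_image[OF i]
    unfolding homeomorphic_maps_def by metis
  moreover have "homeomorphic_map X X g"
    using g by (auto simp: homeomorphic_maps_map)
  ultimately have "homeomorphic_map X X (inv_into UNIV f)"
    by (auto intro: homeomorphic_map_eq)
  then show "\<exists>h\<in>carrier (Homeo X). h \<otimes>\<^bsub>Homeo X\<^esub> f = \<one>\<^bsub>Homeo X\<^esub>"
    using i permutes_inv_o(2)[OF f(1)] by (auto simp: Homeo_def intro!: bexI[of _ "inv_into UNIV f"])
qed (auto simp: Homeo_def permutes_compose homeomorphic_map_compose permutes_id o_assoc)

end

theory Submission
  imports Defs
begin

text \<open>
  Two facts carry the proof.

  First, every nontrivial subgroup \<open>N\<close> of \<open>Homeo X\<close> that is normalised by \<open>B\<close> contains \<open>B\<close>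
  (\<open>locally_moving_simple_le_normalized\<close>). Some \<open>n \<in> N\<close> displaces an open set \<open>U\<close> from itself. For
  \<open>b\<close>, \<open>c\<close> in \<open>B\<close> supported in \<open>U\<close>, the commutator \<open>[b,n]\<close> is \<open>b\<close> times an element supported in
  \<open>n U\<close>, which \<open>c\<close> does not see; hence \<open>[[b,n],c] = [b,c]\<close>, and this lies in both \<open>N\<close> and \<open>B\<close>.
  Since \<open>B\<close> is locally moving, \<open>b\<close> and \<open>c\<close> can be chosen not to commute, so \<open>N \<inter> B\<close> is a
  nontrivial normal subgroup of the simple group \<open>B\<close>.

  Second, \<open>G/N\<close> is abelian whenever \<open>N\<close> is normal in \<open>G\<close> and contains \<open>B\<close>
  (\<open>comm_group_Mod_base\<close>). Splitting off one singularity at a time shows that \<open>G\<close> is generated by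
  elements with at most one singular point. Let \<open>g\<close> and \<open>h\<close> be singular at most at \<open>p\<close> and at \<open>q\<close>.
  If \<open>p = q\<close>, conjugate \<open>h\<close> by an element of \<open>B\<close> that moves \<open>q\<close>; its class modulo \<open>N\<close> stays the same.
  So assume \<open>p \<noteq> q\<close>. As \<open>g\<close> is regular at \<open>q\<close>, an element of \<open>B\<close> composed with \<open>g\<close> gives \<open>u\<close> that
  is the identity near \<open>q\<close>; likewise \<open>h\<close> is replaced by \<open>v\<close> that is the identity near \<open>p\<close>. Now
  \<open>[u,v]\<close> has no singularity (\<open>commutator_mem_base\<close>), so it lies in \<open>B\<close> and dies in \<open>G/N\<close>.

  Together these show that every proper quotient of \<open>G\<close> is abelian. For the simplicity of \<open>G'\<close>, let
  \<open>K\<close> be a nontrivial normal subgroup of \<open>G'\<close>. The first fact gives \<open>B \<subseteq> G'\<close>, so \<open>K\<close> is normalised by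
  all conjugates \<open>g B g\<^sup>-\<^sup>1\<close> with \<open>g \<in> G\<close>. The first fact for these conjugates puts all of them into \<open>K\<close>.
  Therefore \<open>B\<close> lies in the normal core of \<open>K\<close> in \<open>G\<close>, the quotient of \<open>G\<close> by the core is abelian,
  and \<open>G'\<close> is contained in the core and so in \<open>K\<close>.
\<close>

section \<open>Homeomorphisms as elements of a group\<close>

lemma mult_Homeo [simp]: "f \<otimes>\<^bsub>Homeo X\<^esub> g = f \<circ> g"
  and one_Homeo [simp]: "\<one>\<^bsub>Homeo X\<^esub> = id"
  by (auto simp: Homeo_def)

lemma Homeo_inv_apply:
  assumes "f \<in> carrier (Homeo X)"
  shows "(inv\<^bsub>Homeo X\<^esub> f) (f x) = x" "f ((inv\<^bsub>Homeo X\<^esub> f) x) = x"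
  using group.l_inv[OF group_Homeo assms] group.r_inv[OF group_Homeo assms]
  by (simp_all add: fun_eq_iff)

lemma Homeo_inj: "f \<in> carrier (Homeo X) \<Longrightarrow> f x = f y \<longleftrightarrow> x = y"
  by (metis Homeo_inv_apply(1))

lemma Homeo_outside: "f \<in> carrier (Homeo X) \<Longrightarrow> x \<notin> topspace X \<Longrightarrow> f x = x"
  by (auto simp: Homeo_def permutes_def)

lemma Homeo_in_topspace: "f \<in> carrier (Homeo X) \<Longrightarrow> f x \<in> topspace X \<longleftrightarrow> x \<in> topspace X"
  by (auto simp: Homeo_def permutes_in_image)

lemma Homeo_continuous: "f \<in> carrier (Homeo X) \<Longrightarrow> continuous_map X X f"
  by (auto simp: Homeo_def homeomorphic_imp_continuous_map)

lemma Homeo_inv_closed: "f \<in> carrier (Homeo X) \<Longrightarrow> inv\<^bsub>Homeo X\<^esub> f \<in> carrier (Homeo X)"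
  by (rule group.inv_closed[OF group_Homeo])

lemma subgroup_Homeo_comp:
  "subgroup S (Homeo X) \<Longrightarrow> f \<in> S \<Longrightarrow> g \<in> S \<Longrightarrow> f \<circ> g \<in> S"
  using subgroup.m_closed by fastforce

section \<open>Germs of homeomorphisms\<close>

lemma agree_near_refl: "p \<in> topspace X \<Longrightarrow> agree_near X p f f"
  unfolding agree_near_def by blast

lemma agree_near_trans:
  assumes "agree_near X p f g" "agree_near X p g h"
  shows "agree_near X p f h"
proof -
  obtain U V where "openin X U" "p \<in> U" "\<forall>x\<in>U. f x = g x"
    and "openin X V" "p \<in> V" "\<forall>x\<in>V. g x = h x"
    using assms unfolding agree_near_def by blast
  then have "openin X (U \<inter> V)" "p \<in> U \<inter> V" "\<forall>x\<in>U \<inter> V. f x = h x"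
    by auto
  then show ?thesis
    unfolding agree_near_def by blast
qed

lemma agree_near_comp:
  assumes "f' \<in> carrier (Homeo X)" and "agree_near X p f f'" "agree_near X (f p) g g'"
  shows "agree_near X p (g \<circ> f) (g' \<circ> f')"
proof -
  obtain U V where U: "openin X U" "p \<in> U" "\<forall>x\<in>U. f x = f' x"
    and V: "openin X V" "f p \<in> V" "\<forall>x\<in>V. g x = g' x"
    using assms unfolding agree_near_def by blast
  let ?W = "U \<inter> {x \<in> topspace X. f' x \<in> V}"
  have "openin X ?W"
    using U(1) openin_continuous_map_preimage[OF Homeo_continuous[OF assms(1)] V(1)] by auto
  moreover have "p \<in> ?W"
    using U V openin_subset[OF U(1)] by auto
  moreover have "\<forall>x\<in>?W. (g \<circ> f) x = (g' \<circ> f') x"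
    using U V by auto
  ultimately show ?thesis
    unfolding agree_near_def by blast
qed

lemma agree_near_inv:
  assumes f: "f \<in> carrier (Homeo X)" and g: "g \<in> carrier (Homeo X)" and "agree_near X p f g"
  shows "agree_near X (f p) (inv\<^bsub>Homeo X\<^esub> f) (inv\<^bsub>Homeo X\<^esub> g)"
proof -
  obtain U where U: "openin X U" "p \<in> U" "\<forall>x\<in>U. f x = g x"
    using assms unfolding agree_near_def by blast
  let ?W = "{y \<in> topspace X. (inv\<^bsub>Homeo X\<^esub> f) y \<in> U}"
  have "openin X ?W"
    by (rule openin_continuous_map_preimage[OF Homeo_continuous[OF Homeo_inv_closed[OF f]] U(1)])
  moreover have "f p \<in> ?W"
    using U(2) openin_subset[OF U(1)] Homeo_inv_apply(1)[OF f] Homeo_in_topspace[OF f]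
    by (metis (mono_tags, lifting) mem_Collect_eq subsetD)
  moreover have "(inv\<^bsub>Homeo X\<^esub> f) y = (inv\<^bsub>Homeo X\<^esub> g) y" if "y \<in> ?W" for y
  proof -
    have "y = g ((inv\<^bsub>Homeo X\<^esub> f) y)"
      using that U(3) Homeo_inv_apply(2)[OF f, of y] by auto
    then show ?thesis
      using Homeo_inv_apply(1)[OF g, of "(inv\<^bsub>Homeo X\<^esub> f) y"] by simp
  qed
  ultimately show ?thesis
    unfolding agree_near_def by blast
qed

definition regular_at :: "'a topology \<Rightarrow> ('a \<Rightarrow> 'a) set \<Rightarrow> ('a \<Rightarrow> 'a) \<Rightarrow> 'a \<Rightarrow> bool" where
  "regular_at X B f p \<longleftrightarrow> (\<exists>b\<in>B. agree_near X p f b)"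

lemma sing_iff: "p \<in> sing X B f \<longleftrightarrow> p \<in> topspace X \<and> \<not> regular_at X B f p"
  by (auto simp: sing_def regular_at_def)

lemma regular_at_base: "b \<in> B \<Longrightarrow> p \<in> topspace X \<Longrightarrow> regular_at X B b p"
  unfolding regular_at_def by (blast intro: agree_near_refl)

lemma regular_at_cong: "agree_near X p f g \<Longrightarrow> regular_at X B g p \<Longrightarrow> regular_at X B f p"
  unfolding regular_at_def by (blast intro: agree_near_trans)

lemma regular_at_comp:
  assumes B: "subgroup B (Homeo X)"
    and "regular_at X B f p" "regular_at X B g (f p)"
  shows "regular_at X B (g \<circ> f) p"
proof -
  obtain b c where b: "b \<in> B" "agree_near X p f b" and c: "c \<in> B" "agree_near X (f p) g c"
    using assms(2,3) unfolding regular_at_def by blast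
  have "agree_near X p (g \<circ> f) (c \<circ> b)"
    using subgroup.mem_carrier[OF B b(1)] b(2) c(2) by (rule agree_near_comp)
  moreover have "c \<circ> b \<in> B"
    using B c(1) b(1) by (rule subgroup_Homeo_comp)
  ultimately show ?thesis
    unfolding regular_at_def by blast
qed

lemma regular_at_inv:
  assumes B: "subgroup B (Homeo X)" and f: "f \<in> carrier (Homeo X)"
    and r: "regular_at X B f ((inv\<^bsub>Homeo X\<^esub> f) y)"
  shows "regular_at X B (inv\<^bsub>Homeo X\<^esub> f) y"
proof -
  obtain b where b: "b \<in> B" "agree_near X ((inv\<^bsub>Homeo X\<^esub> f) y) f b"
    using r unfolding regular_at_def by blast
  have "agree_near X y (inv\<^bsub>Homeo X\<^esub> f) (inv\<^bsub>Homeo X\<^esub> b)"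
    using agree_near_inv[OF f subgroup.mem_carrier[OF B b(1)] b(2)] f
    by (simp add: Homeo_inv_apply)
  then show ?thesis
    unfolding regular_at_def using subgroup.m_inv_closed[OF B b(1)] by blast
qed

lemma sing_base_comp:
  assumes B: "subgroup B (Homeo X)" and "b \<in> B" and f: "f \<in> carrier (Homeo X)"
  shows "sing X B (b \<circ> f) \<subseteq> sing X B f"
proof
  fix x assume x: "x \<in> sing X B (b \<circ> f)"
  then have xt: "x \<in> topspace X" "f x \<in> topspace X"
    using Homeo_in_topspace[OF f] by (auto simp: sing_iff)
  then have "\<not> regular_at X B f x"
    using x regular_at_comp[OF B, of f x b] regular_at_base[OF \<open>b \<in> B\<close>] by (auto simp: sing_iff)
  then show "x \<in> sing X B f"
    using xt by (simp add: sing_iff)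
qed

lemma sing_conj_base:
  assumes B: "subgroup B (Homeo X)" and b: "b \<in> B" and f: "f \<in> carrier (Homeo X)"
  shows "sing X B (b \<circ> (f \<circ> inv\<^bsub>Homeo X\<^esub> b)) \<subseteq> b ` sing X B f"
proof
  fix x assume x: "x \<in> sing X B (b \<circ> (f \<circ> inv\<^bsub>Homeo X\<^esub> b))"
  let ?b' = "inv\<^bsub>Homeo X\<^esub> b"
  have bH: "b \<in> carrier (Homeo X)" and b'B: "?b' \<in> B" and b'H: "?b' \<in> carrier (Homeo X)"
    using subgroup.mem_carrier[OF B] subgroup.m_inv_closed[OF B b] b by auto
  have xt: "x \<in> topspace X" "?b' x \<in> topspace X" and "f (?b' x) \<in> topspace X"
    using x f b'H by (auto simp: sing_iff Homeo_in_topspace)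
  then have "\<not> regular_at X B f (?b' x)"
    using x regular_at_comp[OF B, of ?b' x f] regular_at_comp[OF B, of "f \<circ> ?b'" x b]
      regular_at_base[OF b] regular_at_base[OF b'B] by (auto simp: sing_iff)
  then have "?b' x \<in> sing X B f"
    using xt by (simp add: sing_iff)
  then show "x \<in> b ` sing X B f"
    using Homeo_inv_apply(2)[OF bH, of x] by (auto intro: image_eqI[of x b "?b' x"])
qed

text \<open>Dividing \<open>g\<close> on the right by a homeomorphism that shares its germ at \<open>p\<close> and has no other
  singularity removes \<open>p\<close> from the singular set; the other singular points are merely moved
  by \<open>h\<close>.\<close>

lemma sing_cancel:
  assumes B: "subgroup B (Homeo X)"
    and g: "g \<in> carrier (Homeo X)" and h: "h \<in> carrier (Homeo X)"
    and h_sing: "sing X B h = {p}" and agree: "agree_near X p h g"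
  shows "sing X B (g \<circ> inv\<^bsub>Homeo X\<^esub> h) \<subseteq> h ` (sing X B g - {p})"
proof
  fix x assume x: "x \<in> sing X B (g \<circ> inv\<^bsub>Homeo X\<^esub> h)"
  let ?h' = "inv\<^bsub>Homeo X\<^esub> h" and ?y = "(inv\<^bsub>Homeo X\<^esub> h) x"
  have h': "?h' \<in> carrier (Homeo X)"
    using h by (rule Homeo_inv_closed)
  have hy: "h ?y = x" and xt: "x \<in> topspace X" and yt: "?y \<in> topspace X"
    using x h h' by (auto simp: sing_iff Homeo_inv_apply Homeo_in_topspace)
  have "?y \<noteq> p"
  proof
    assume yp: "?y = p"
    have "agree_near X x ?h' (inv\<^bsub>Homeo X\<^esub> g)"
      using agree_near_inv[OF h g agree] hy yp by simp
    moreover have "agree_near X (?h' x) g g"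
      using yt by (rule agree_near_refl)
    ultimately have "agree_near X x (g \<circ> ?h') (g \<circ> inv\<^bsub>Homeo X\<^esub> g)"
      by (rule agree_near_comp[OF Homeo_inv_closed[OF g]])
    moreover have "g \<circ> inv\<^bsub>Homeo X\<^esub> g = id"
      using g by (simp add: fun_eq_iff Homeo_inv_apply)
    moreover have "id \<in> B"
      using subgroup.one_closed[OF B] by simp
    ultimately have "regular_at X B (g \<circ> ?h') x"
      unfolding regular_at_def by auto
    then show False
      using x by (simp add: sing_iff)
  qed
  moreover have "?y \<in> sing X B g"
  proof -
    have "regular_at X B h ?y"
      using \<open>?y \<noteq> p\<close> h_sing yt sing_iff[of ?y X B h] by simp
    then have "regular_at X B ?h' x"
      by (rule regular_at_inv[OF B h])
    then have "\<not> regular_at X B g ?y"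
      using x regular_at_comp[OF B, of ?h' x g] by (auto simp: sing_iff)
    then show ?thesis
      using yt by (simp add: sing_iff)
  qed
  ultimately show "x \<in> h ` (sing X B g - {p})"
    using hy by (intro image_eqI[of x h ?y]) auto
qed

section \<open>Locally moving groups\<close>

lemma comp_commute_disjoint_support:
  assumes "inj f" "inj g" and "\<And>x. f x = x \<or> g x = x"
  shows "f \<circ> g = g \<circ> f"
proof
  fix x
  show "(f \<circ> g) x = (g \<circ> f) x"
  proof (cases "f x = x")
    case True
    then show ?thesis
      using assms(3)[of "g x"] injD[OF assms(2), of "g x" x] by auto
  next
    case False
    then show ?thesis
      using assms(3)[of x] assms(3)[of "f x"] injD[OF assms(1), of "f x" x] by auto
  qed
qed

lemma Hausdorff_displaced_neighbourhood:
  assumes X: "Hausdorff_space X" and n: "n \<in> carrier (Homeo X)" and "n p \<noteq> p"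
  obtains U where "openin X U" "p \<in> U" "\<And>x. x \<in> U \<Longrightarrow> n x \<notin> U"
proof -
  have "p \<in> topspace X" "n p \<in> topspace X"
    using \<open>n p \<noteq> p\<close> Homeo_outside[OF n, of p] Homeo_in_topspace[OF n, of p] by auto
  then obtain V W where V: "openin X V" "p \<in> V" and W: "openin X W" "n p \<in> W" and "disjnt V W"
    using X \<open>n p \<noteq> p\<close> unfolding Hausdorff_space_def by metis
  let ?U = "V \<inter> {x \<in> topspace X. n x \<in> W}"
  have "openin X ?U"
    using V openin_continuous_map_preimage[OF Homeo_continuous[OF n] W(1)] by auto
  moreover have "p \<in> ?U"
    using V W \<open>p \<in> topspace X\<close> by auto
  moreover have "n x \<notin> ?U" if "x \<in> ?U" for x
    using that \<open>disjnt V W\<close> by (auto simp: disjnt_iff)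
  ultimately show thesis
    using that by blast
qed

lemma locally_movingE:
  assumes "locally_moving X B" and B: "subgroup B (Homeo X)" and "openin X U" "U \<noteq> {}"
  obtains b p where "b \<in> B" "p \<in> U" "b p \<noteq> p" "\<And>x. x \<notin> U \<Longrightarrow> b x = x"
proof -
  obtain b where b: "b \<in> B" "b \<noteq> id" "\<forall>x\<in>topspace X - U. b x = x"
    using assms unfolding locally_moving_def by blast
  have fix_b: "b x = x" if "x \<notin> U" for x
    using that b Homeo_outside[OF subgroup.mem_carrier[OF B b(1)]] by (cases "x \<in> topspace X") auto
  moreover obtain p where "b p \<noteq> p"
    using b(2) by (auto simp: fun_eq_iff)
  ultimately show thesis
    using that b(1) by blast
qed

text \<open>If \<open>b\<close> is supported in \<open>U\<close> and displaces a smaller open set \<open>V\<close>, then no nontrivial element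
  supported in \<open>V\<close> commutes with \<open>b\<close>.\<close>

lemma locally_moving_noncommuting:
  assumes X: "Hausdorff_space X" and lm: "locally_moving X B" and B: "subgroup B (Homeo X)"
    and U: "openin X U" "U \<noteq> {}"
  obtains b c where "b \<in> B" "c \<in> B" "\<And>x. x \<notin> U \<Longrightarrow> b x = x" "\<And>x. x \<notin> U \<Longrightarrow> c x = x"
    "b \<circ> c \<noteq> c \<circ> b"
proof -
  obtain b q where b: "b \<in> B" "q \<in> U" "b q \<noteq> q" "\<And>x. x \<notin> U \<Longrightarrow> b x = x"
    using locally_movingE[OF lm B U] by blast
  have bH: "b \<in> carrier (Homeo X)"
    using subgroup.mem_carrier[OF B b(1)] .
  obtain V where V: "openin X V" "q \<in> V" "\<And>x. x \<in> V \<Longrightarrow> b x \<notin> V"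
    using Hausdorff_displaced_neighbourhood[OF X bH b(3)] by blast
  have "openin X (V \<inter> U)" "V \<inter> U \<noteq> {}"
    using V b U by auto
  then obtain c r where c: "c \<in> B" "r \<in> V \<inter> U" "c r \<noteq> r" "\<And>x. x \<notin> V \<inter> U \<Longrightarrow> c x = x"
    using locally_movingE[OF lm B] by metis
  have "c (b r) = b r"
    using V c by auto
  moreover have "b (c r) \<noteq> b r"
    using c(3) Homeo_inj[OF bH] by blast
  ultimately have "b \<circ> c \<noteq> c \<circ> b"
    by (metis comp_apply)
  then show thesis
    using that[of b c] b c by auto
qed

lemma (in group) inv_cancel_left:
  assumes "x \<in> carrier G" "y \<in> carrier G"
  shows "inv x \<otimes> (x \<otimes> y) = y" "x \<otimes> (inv x \<otimes> y) = y"
  using assms by (simp_all add: m_assoc[symmetric])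

lemma (in group) commutator_one_iff:
  assumes "b \<in> carrier G" "c \<in> carrier G"
  shows "b \<otimes> (c \<otimes> (inv b \<otimes> inv c)) = \<one> \<longleftrightarrow> b \<otimes> c = c \<otimes> b"
proof -
  have "b \<otimes> (c \<otimes> (inv b \<otimes> inv c)) = (b \<otimes> c) \<otimes> inv (c \<otimes> b)"
    using assms by (simp add: m_assoc inv_mult_group)
  also have "\<dots> = \<one> \<longleftrightarrow> b \<otimes> c = c \<otimes> b"
    using assms inv_solve_right'[of \<one> "b \<otimes> c" "c \<otimes> b"] by auto
  finally show ?thesis .
qed

text \<open>With \<open>m = n b\<^sup>-\<^sup>1 n\<^sup>-\<^sup>1\<close> one has \<open>[b,n] = b m\<close>, and since \<open>m\<close> commutes with \<open>c\<close> it cancels from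
  \<open>[b m, c]\<close>, leaving \<open>[b,c]\<close>. The order of the brackets in the commutators suits rewriting with
  associativity to the right.\<close>

lemma (in group) double_commutator_mem:
  assumes N: "subgroup N G" and n: "n \<in> N" and b: "b \<in> carrier G" and c: "c \<in> carrier G"
    and norm_b: "\<And>x. x \<in> N \<Longrightarrow> b \<otimes> x \<otimes> inv b \<in> N"
    and norm_c: "\<And>x. x \<in> N \<Longrightarrow> c \<otimes> x \<otimes> inv c \<in> N"
    and comm: "(n \<otimes> inv b \<otimes> inv n) \<otimes> c = c \<otimes> (n \<otimes> inv b \<otimes> inv n)"
  shows "b \<otimes> (c \<otimes> (inv b \<otimes> inv c)) \<in> N"
proof -
  define m where "m = n \<otimes> inv b \<otimes> inv n"
  have nG: "n \<in> carrier G"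
    using subgroup.mem_carrier[OF N n] .
  have m: "m \<in> carrier G" and mc: "m \<otimes> c = c \<otimes> m"
    using nG b comm by (auto simp: m_def)
  have "(b \<otimes> n \<otimes> inv b) \<otimes> inv n \<in> N"
    using N n norm_b by (simp add: subgroup.m_closed subgroup.m_inv_closed)
  then have bm: "b \<otimes> m \<in> N"
    using nG b by (simp add: m_def m_assoc)
  then have "(b \<otimes> m) \<otimes> (c \<otimes> inv (b \<otimes> m) \<otimes> inv c) \<in> N"
    using N norm_c by (simp add: subgroup.m_closed subgroup.m_inv_closed)
  also have "(b \<otimes> m) \<otimes> (c \<otimes> inv (b \<otimes> m) \<otimes> inv c) = b \<otimes> ((m \<otimes> c) \<otimes> (inv m \<otimes> (inv b \<otimes> inv c)))"
    using b c m by (simp add: m_assoc inv_mult_group)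
  also have "\<dots> = b \<otimes> (c \<otimes> (m \<otimes> (inv m \<otimes> (inv b \<otimes> inv c))))"
    using b c m by (simp add: mc m_assoc)
  also have "\<dots> = b \<otimes> (c \<otimes> (inv b \<otimes> inv c))"
    using b c m by (simp add: inv_cancel_left)
  finally show ?thesis .
qed

text \<open>The double commutator argument: an element of \<open>N\<close> that displaces an open set \<open>U\<close> lets commutators
  of elements of \<open>B\<close> supported in \<open>U\<close> be recovered inside \<open>N\<close>.\<close>

lemma locally_moving_simple_le_normalized:
  assumes X: "Hausdorff_space X" and lm: "locally_moving X B" and B: "subgroup B (Homeo X)"
    and simple: "is_simple (subgrp X B)"
    and N: "subgroup N (Homeo X)" and nontriv: "N \<noteq> {id}"
    and norm: "\<And>b x. b \<in> B \<Longrightarrow> x \<in> N \<Longrightarrow> b \<circ> x \<circ> inv\<^bsub>Homeo X\<^esub> b \<in> N"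
  shows "B \<subseteq> N"
proof -
  interpret H: group "Homeo X" by (rule group_Homeo)
  interpret B: group "subgrp X B" using B by (rule H.subgroup_imp_group)
  obtain n p where n: "n \<in> N" "n p \<noteq> p"
  proof -
    have "id \<in> N"
      using subgroup.one_closed[OF N] by simp
    then obtain n where "n \<in> N" "n \<noteq> id"
      using nontriv by blast
    then show thesis
      using that by (auto simp: fun_eq_iff)
  qed
  have nH: "n \<in> carrier (Homeo X)"
    using subgroup.mem_carrier[OF N n(1)] .
  obtain U where U: "openin X U" "p \<in> U" "\<And>x. x \<in> U \<Longrightarrow> n x \<notin> U"
    using Hausdorff_displaced_neighbourhood[OF X nH n(2)] by blast
  have "U \<noteq> {}"
    using U(2) by blast
  obtain b c where b: "b \<in> B" "\<And>x. x \<notin> U \<Longrightarrow> b x = x"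
    and c: "c \<in> B" "\<And>x. x \<notin> U \<Longrightarrow> c x = x" and bc: "b \<circ> c \<noteq> c \<circ> b"
    by (rule locally_moving_noncommuting[OF X lm B U(1) \<open>U \<noteq> {}\<close>]) (rule that)
  have bH: "b \<in> carrier (Homeo X)" and cH: "c \<in> carrier (Homeo X)"
    using b c subgroup.mem_carrier[OF B] by auto
  let ?i = "m_inv (Homeo X)"
  define m where "m = n \<circ> ?i b \<circ> ?i n"
  have mH: "m \<in> carrier (Homeo X)"
    using H.m_closed[OF H.m_closed[OF nH H.inv_closed[OF bH]] H.inv_closed[OF nH]]
    by (simp add: m_def)
  \<comment> \<open>\<open>m\<close> is supported in the image of \<open>U\<close> under \<open>n\<close>, which is disjoint from \<open>U\<close>.\<close>
  have "m x = x \<or> c x = x" for x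
  proof (cases "x \<in> U")
    case True
    then have "?i n x \<notin> U"
      using U(3)[of "?i n x"] Homeo_inv_apply(2)[OF nH, of x] by auto
    then have "?i b (?i n x) = ?i n x"
      using b(2)[of "?i n x"] Homeo_inv_apply(1)[OF bH, of "?i n x"] by simp
    then show ?thesis
      using Homeo_inv_apply(2)[OF nH] by (simp add: m_def)
  qed (use c(2) in auto)
  then have "m \<circ> c = c \<circ> m"
    using Homeo_inj[OF mH] Homeo_inj[OF cH]
    by (intro comp_commute_disjoint_support) (auto intro: injI)
  then have comm_N: "b \<circ> (c \<circ> (?i b \<circ> ?i c)) \<in> N"
    using H.double_commutator_mem[OF N n(1) bH cH] norm b(1) c(1) by (simp add: m_def)
  have comm_B: "b \<circ> (c \<circ> (?i b \<circ> ?i c)) \<in> B"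
    by (intro subgroup_Homeo_comp[OF B] subgroup.m_inv_closed[OF B] b(1) c(1))
  have comm_ne: "b \<circ> (c \<circ> (?i b \<circ> ?i c)) \<noteq> id"
    using H.commutator_one_iff[OF bH cH] bc by simp
  have "N \<inter> B \<lhd> subgrp X B"
  proof (rule B.normal_invI)
    have "subgroup (N \<inter> B) (Homeo X)"
      using N B by (rule H.subgroups_Inter_pair)
    then show "subgroup (N \<inter> B) (subgrp X B)"
      using H.subgroup_incl[OF _ B] by simp
  next
    fix x h assume "x \<in> carrier (subgrp X B)" "h \<in> N \<inter> B"
    then show "x \<otimes>\<^bsub>subgrp X B\<^esub> h \<otimes>\<^bsub>subgrp X B\<^esub> inv\<^bsub>subgrp X B\<^esub> x \<in> N \<inter> B"
      using norm subgroup.m_inv_closed[OF B] subgroup_Homeo_comp[OF B]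
      by (simp add: H.m_inv_consistent[OF B])
  qed
  then have "N \<inter> B = {id} \<or> N \<inter> B = B"
    using simple unfolding is_simple_def by auto
  then show ?thesis
    using comm_N comm_B comm_ne by blast
qed

lemma (in group) conjugate_preimage_subgroup:
  assumes K: "subgroup K G" and g: "g \<in> carrier G"
  shows "subgroup {x \<in> carrier G. g \<otimes> x \<otimes> inv g \<in> K} G" (is "subgroup ?S G")
proof (rule subgroupI)
  have "\<one> \<in> ?S"
    using g subgroup.one_closed[OF K] by auto
  then show "?S \<noteq> {}"
    by blast
next
  fix a assume "a \<in> ?S"
  then have a: "a \<in> carrier G" "g \<otimes> a \<otimes> inv g \<in> K"
    by auto
  then show "inv a \<in> ?S"
    using g subgroup.m_inv_closed[OF K a(2)] by (simp add: inv_mult_group m_assoc)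
next
  fix a b assume a: "a \<in> ?S" and b: "b \<in> ?S"
  have "(g \<otimes> a \<otimes> inv g) \<otimes> (g \<otimes> b \<otimes> inv g) = g \<otimes> (a \<otimes> b) \<otimes> inv g"
    using g a b by (simp add: m_assoc inv_cancel_left)
  then show "a \<otimes> b \<in> ?S"
    using subgroup.m_closed[OF K, of "g \<otimes> a \<otimes> inv g" "g \<otimes> b \<otimes> inv g"] a b by simp
qed auto

text \<open>The argument for \<open>B\<close> applies verbatim to the conjugate \<open>g B g\<^sup>-\<^sup>1\<close>; it is transported by passing
  from \<open>K\<close> to \<open>g\<^sup>-\<^sup>1 K g\<close>.\<close>

lemma locally_moving_simple_conj_le_normalized:
  assumes X: "Hausdorff_space X" and lm: "locally_moving X B" and B: "subgroup B (Homeo X)"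
    and simple: "is_simple (subgrp X B)" and g: "g \<in> carrier (Homeo X)"
    and K: "subgroup K (Homeo X)" and nontriv: "K \<noteq> {id}"
    and norm: "\<And>c k. c \<in> B \<Longrightarrow> k \<in> K \<Longrightarrow>
      (g \<circ> c \<circ> inv\<^bsub>Homeo X\<^esub> g) \<circ> k \<circ> inv\<^bsub>Homeo X\<^esub> (g \<circ> c \<circ> inv\<^bsub>Homeo X\<^esub> g) \<in> K"
    and b: "b \<in> B"
  shows "g \<circ> b \<circ> inv\<^bsub>Homeo X\<^esub> g \<in> K"
proof -
  interpret H: group "Homeo X" by (rule group_Homeo)
  let ?i = "m_inv (Homeo X)"
  let ?K = "{x \<in> carrier (Homeo X). g \<circ> x \<circ> ?i g \<in> K}"
  have "subgroup ?K (Homeo X)"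
    using H.conjugate_preimage_subgroup[OF K g] by simp
  moreover have "?K \<noteq> {id}"
  proof -
    obtain k where k: "k \<in> K" "k \<noteq> id"
      using nontriv subgroup.one_closed[OF K] by auto
    let ?k = "?i g \<circ> k \<circ> g"
    have conj: "g \<circ> ?k \<circ> ?i g = k"
      using g by (simp add: fun_eq_iff Homeo_inv_apply)
    moreover have "?k \<in> carrier (Homeo X)"
      using H.m_closed[OF H.m_closed[OF H.inv_closed[OF g] subgroup.mem_carrier[OF K k(1)]] g] by simp
    moreover have "?k \<noteq> id"
    proof
      assume "?k = id"
      then have "g \<circ> ?k \<circ> ?i g = g \<circ> id \<circ> ?i g"
        by (simp only:)
      also have "\<dots> = id"
        using g by (simp add: fun_eq_iff Homeo_inv_apply)
      finally show False
        using conj k(2) by simp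
    qed
    ultimately show ?thesis
      using k(1) by force
  qed
  moreover have "c \<circ> x \<circ> ?i c \<in> ?K" if c: "c \<in> B" and x: "x \<in> ?K" for c x
  proof -
    have cH: "c \<in> carrier (Homeo X)" and xH: "x \<in> carrier (Homeo X)"
      using x subgroup.mem_carrier[OF B c] by auto
    let ?c = "g \<circ> c \<circ> ?i g"
    have cK: "?c \<circ> (g \<circ> x \<circ> ?i g) \<circ> ?i ?c \<in> K"
      using norm c x by blast
    have "?i ?c = g \<circ> ?i c \<circ> ?i g"
      using H.inv_mult_group[of "g \<circ> c" "?i g"] H.inv_mult_group[of g c] g cH
        H.m_closed[of g c] by (simp add: comp_assoc)
    then have "?c \<circ> (g \<circ> x \<circ> ?i g) \<circ> ?i ?c = g \<circ> (c \<circ> x \<circ> ?i c) \<circ> ?i g"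
      using g by (simp add: fun_eq_iff Homeo_inv_apply)
    moreover have "c \<circ> x \<circ> ?i c \<in> carrier (Homeo X)"
      using H.m_closed[OF H.m_closed[OF cH xH] H.inv_closed[OF cH]] by simp
    ultimately show ?thesis
      using cK by simp
  qed
  ultimately have "B \<subseteq> ?K"
    by (rule locally_moving_simple_le_normalized[OF X lm B simple])
  then show ?thesis
    using b by blast
qed

section \<open>Commuting modulo the base group\<close>

lemma finite_germ_extensionD:
  assumes "finite_germ_extension X B G"
  shows "subgroup B (Homeo X)" "subgroup G (Homeo X)" "B \<subseteq> G"
    and "\<And>g. g \<in> G \<Longrightarrow> finite (sing X B g)"
    and "\<And>g. g \<in> G \<Longrightarrow> sing X B g = {} \<Longrightarrow> g \<in> B"
    and "\<And>g p. g \<in> G \<Longrightarrow> p \<in> sing X B g \<Longrightarrow> \<exists>h\<in>G. sing X B h = {p} \<and> agree_near X p h g"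
proof -
  from assms have B_eq: "B = {g \<in> G. sing X B g = {}}"
    unfolding finite_germ_extension_def by (elim conjE)
  show "g \<in> B" if "g \<in> G" "sing X B g = {}" for g
    using that by (subst B_eq) simp
qed (use assms in \<open>auto simp: finite_germ_extension_def\<close>)

text \<open>The last axiom of a finite germ extension supplies, for a singular point \<open>p\<close> of \<open>g\<close>, an \<open>h\<close> with the
  same germ at \<open>p\<close> that is regular elsewhere; \<open>g h\<^sup>-\<^sup>1\<close> then has fewer singular points than \<open>g\<close>. Allowing
  an empty singular set in the one-point case lets one case also cover the elements of \<open>B\<close>; this
  is why a point of the space has to exist.\<close>

lemma finite_germ_extension_induct [consumes 2, case_names one_point comp]:
  assumes fge: "finite_germ_extension X B G" and g: "g \<in> G"
    and one_point: "\<And>g p. g \<in> G \<Longrightarrow> p \<in> topspace X \<Longrightarrow> sing X B g \<subseteq> {p} \<Longrightarrow> P g"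
    and comp: "\<And>g h. g \<in> G \<Longrightarrow> h \<in> G \<Longrightarrow> P g \<Longrightarrow> P h \<Longrightarrow> P (g \<circ> h)"
    and nonempty: "topspace X \<noteq> {}"
  shows "P g"
  using g
proof (induction "card (sing X B g)" arbitrary: g rule: less_induct)
  case less
  note D = finite_germ_extensionD[OF fge]
  show ?case
  proof (cases "sing X B g = {}")
    case True
    then show ?thesis
      using one_point[OF less.prems] nonempty by blast
  next
    case False
    then obtain p where p: "p \<in> sing X B g"
      by blast
    then obtain h where h: "h \<in> G" "sing X B h = {p}" "agree_near X p h g"
      using D(6)[OF less.prems] by blast
    let ?k = "g \<circ> inv\<^bsub>Homeo X\<^esub> h"
    have hH: "h \<in> carrier (Homeo X)" and gH: "g \<in> carrier (Homeo X)"
      using subgroup.mem_carrier[OF D(2)] h less.prems by auto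
    have k: "?k \<in> G"
      by (intro subgroup_Homeo_comp[OF D(2)] subgroup.m_inv_closed[OF D(2)] less.prems h(1))
    have fin: "finite (sing X B g)"
      using D(4)[OF less.prems] .
    have "card (sing X B ?k) \<le> card (h ` (sing X B g - {p}))"
      using sing_cancel[OF D(1) gH hH h(2,3)] fin by (intro card_mono) auto
    also have "\<dots> \<le> card (sing X B g - {p})"
      using fin by (intro card_image_le) auto
    also have "\<dots> < card (sing X B g)"
      using fin p by (rule card_Diff1_less)
    finally have "P ?k"
      using less.hyps k by blast
    moreover have "P h"
      using one_point[OF h(1)] h(2) p by (auto simp: sing_iff)
    moreover have "?k \<circ> h = g"
      using hH by (simp add: fun_eq_iff Homeo_inv_apply)
    ultimately show ?thesis
      using comp[OF k h(1)] by simp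
  qed
qed

text \<open>Follow a point \<open>x\<close> through \<open>v\<^sup>-\<^sup>1\<close>, \<open>u\<^sup>-\<^sup>1\<close>, \<open>v\<close>, \<open>u\<close>. As \<open>u\<close> fixes \<open>q \<noteq> p\<close> and \<open>v\<close> fixes \<open>p \<noteq> q\<close>, injectivity
  gives \<open>u p \<noteq> q\<close> and \<open>v q \<noteq> p\<close>. So at most one of the two maps ever meets its singular point along
  the way, and then it is met by both the map and its inverse, with nothing but an identity germ
  in between.\<close>

lemma commutator_mem_base:
  assumes fge: "finite_germ_extension X B G"
    and u: "u \<in> G" "sing X B u \<subseteq> {p}" and v: "v \<in> G" "sing X B v \<subseteq> {q}"
    and "p \<noteq> q" and uq: "agree_near X q u id" and vp: "agree_near X p v id"
  shows "u \<circ> (v \<circ> (inv\<^bsub>Homeo X\<^esub> u \<circ> inv\<^bsub>Homeo X\<^esub> v)) \<in> B"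
proof (rule finite_germ_extensionD(5)[OF fge])
  note D = finite_germ_extensionD[OF fge]
  interpret H: group "Homeo X" by (rule group_Homeo)
  let ?u' = "inv\<^bsub>Homeo X\<^esub> u" and ?v' = "inv\<^bsub>Homeo X\<^esub> v"
  let ?w = "u \<circ> (v \<circ> (?u' \<circ> ?v'))"
  have uv': "?u' \<in> G" "?v' \<in> G"
    using u v subgroup.m_inv_closed[OF D(2)] by auto
  then show "?w \<in> G"
    by (intro subgroup_Homeo_comp[OF D(2)] u(1) v(1))
  have GH: "\<And>f. f \<in> G \<Longrightarrow> f \<in> carrier (Homeo X)"
    using subgroup.mem_carrier[OF D(2)] .
  note uH = GH[OF u(1)] and vH = GH[OF v(1)] and u'H = GH[OF uv'(1)] and v'H = GH[OF uv'(2)]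
  note iu = Homeo_inv_apply[OF uH] and iv = Homeo_inv_apply[OF vH]
  have idH: "id \<in> carrier (Homeo X)"
    using H.one_closed by simp
  have u_q: "u q = q" and v_p: "v p = p"
    using uq vp unfolding agree_near_def by auto
  have u'q: "agree_near X q ?u' id"
    using agree_near_inv[OF uH idH uq] u_q H.inv_one by simp
  have reg_u: "regular_at X B u x" if "x \<in> topspace X" "x \<noteq> p" for x
    using u(2) that by (auto simp: sing_iff)
  have reg_v: "regular_at X B v x" if "x \<in> topspace X" "x \<noteq> q" for x
    using v(2) that by (auto simp: sing_iff)
  have "regular_at X B ?w x" if x: "x \<in> topspace X" for x
  proof -
    define y where "y = ?v' x"
    define z where "z = ?u' y"
    have yt: "y \<in> topspace X" and zt: "z \<in> topspace X" and vy: "v y = x" and uz: "u z = y"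
      using x u'H v'H by (auto simp: y_def z_def Homeo_in_topspace iu iv)
    have idcong: "agree_near X x (f \<circ> g) g"
      if "agree_near X (g x) f id" "g \<in> carrier (Homeo X)" for f g
      using agree_near_comp[OF that(2) agree_near_refl[OF x] that(1)] by (simp only: id_comp)
    show ?thesis
    proof (cases "y = q")
      \<comment> \<open>The singular germs of \<open>v\<close> and its inverse cancel, because \<open>u\<close> is trivial near \<open>q\<close>.\<close>
      case True
      have "x \<noteq> p"
        using vy v_p True \<open>p \<noteq> q\<close> Homeo_inj[OF vH, of q p] by auto
      have "agree_near X x (?u' \<circ> ?v') ?v'"
        using idcong[OF _ v'H] u'q True y_def by simp
      moreover have "agree_near X ((?u' \<circ> ?v') x) v v"
        using agree_near_refl zt by (simp add: z_def y_def)
      ultimately have "agree_near X x (v \<circ> (?u' \<circ> ?v')) (v \<circ> ?v')"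
        by (rule agree_near_comp[OF v'H])
      moreover have "v \<circ> ?v' = id"
        by (simp add: fun_eq_iff iv)
      moreover have "agree_near X ((v \<circ> (?u' \<circ> ?v')) x) u u"
        using zt vH by (intro agree_near_refl) (simp add: z_def y_def Homeo_in_topspace)
      ultimately have "agree_near X x ?w (u \<circ> id)"
        using agree_near_comp[OF idH, of x "v \<circ> (?u' \<circ> ?v')" u u] by simp
      then show ?thesis
        using regular_at_cong[of X x ?w u B] reg_u[OF x \<open>x \<noteq> p\<close>] by simp
    next
      case yq: False
      have reg_v': "regular_at X B ?v' x"
        using regular_at_inv[OF D(1) vH] reg_v[OF yt yq] by (simp add: y_def)
      show ?thesis
      proof (cases "z = p")
        \<comment> \<open>The singular germs of \<open>u\<close> and its inverse cancel, because \<open>v\<close> is trivial near \<open>p\<close>.\<close>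
        case True
        have "(?u' \<circ> ?v') \<in> carrier (Homeo X)"
          using H.m_closed[OF u'H v'H] by simp
        then have "agree_near X x (v \<circ> (?u' \<circ> ?v')) (?u' \<circ> ?v')"
          using idcong vp True by (simp add: z_def y_def)
        moreover have "agree_near X ((v \<circ> (?u' \<circ> ?v')) x) u u"
          using zt vH by (intro agree_near_refl) (simp add: z_def y_def Homeo_in_topspace)
        ultimately have "agree_near X x ?w (u \<circ> (?u' \<circ> ?v'))"
          by (rule agree_near_comp[OF \<open>(?u' \<circ> ?v') \<in> carrier (Homeo X)\<close>])
        moreover have "u \<circ> (?u' \<circ> ?v') = ?v'"
          by (simp add: fun_eq_iff iu)
        ultimately show ?thesis
          using regular_at_cong[of X x ?w ?v' B] reg_v' by simp
      next
        case zp: False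
        have "z \<noteq> q"
          using yq uz u_q by auto
        moreover have "v z \<noteq> p"
          using zp v_p Homeo_inj[OF vH, of z p] by auto
        moreover have "regular_at X B ?u' y"
          using regular_at_inv[OF D(1) uH] reg_u[OF zt zp] by (simp add: z_def)
        ultimately show ?thesis
          using reg_v' reg_v[OF zt] reg_u[of "v z"] zt vH
          by (intro regular_at_comp[OF D(1)]) (auto simp: z_def y_def Homeo_in_topspace)
      qed
    qed
  qed
  then show "sing X B ?w = {}"
    by (auto simp: sing_iff)
qed

text \<open>Classes modulo \<open>N\<close> ignore factors in \<open>B\<close>, so each one-point element may be replaced by one that is
  trivial near any prescribed regular point; commutation then spreads from one-point elements
  to all of \<open>G\<close>, first in one argument and then in the other.\<close>

lemma comm_group_Mod_base:
  assumes fge: "finite_germ_extension X B G"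
    and no_fix: "\<not> (\<exists>p\<in>topspace X. \<forall>b\<in>B. b p = p)" and nonempty: "topspace X \<noteq> {}"
    and N: "N \<lhd> subgrp X G" and BN: "B \<subseteq> N"
  shows "comm_group (subgrp X G Mod N)"
proof -
  note D = finite_germ_extensionD[OF fge]
  interpret H: group "Homeo X" by (rule group_Homeo)
  interpret N: normal N "subgrp X G" by (rule N)
  define Q where "Q = subgrp X G Mod N"
  interpret Q: group Q unfolding Q_def by (rule N.factorgroup_is_group)
  let ?i = "m_inv (Homeo X)"
  define \<pi> where "\<pi> = (\<lambda>g. N #>\<^bsub>subgrp X G\<^esub> g)"
  have GH: "\<And>f. f \<in> G \<Longrightarrow> f \<in> carrier (Homeo X)"
    using subgroup.mem_carrier[OF D(2)] .
  have invG: "\<And>f. f \<in> G \<Longrightarrow> ?i f \<in> G"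
    using subgroup.m_inv_closed[OF D(2)] .
  note compG = subgroup_Homeo_comp[OF D(2)]
  have hom: "\<pi> \<in> hom (subgrp X G) Q"
    using N.r_coset_hom_Mod by (simp add: \<pi>_def Q_def)
  have \<pi>_carrier: "\<pi> g \<in> carrier Q" if "g \<in> G" for g
    using hom_in_carrier[OF hom] that by simp
  have \<pi>_comp: "\<pi> (f \<circ> g) = \<pi> f \<otimes>\<^bsub>Q\<^esub> \<pi> g" if "f \<in> G" "g \<in> G" for f g
    using hom_mult[OF hom] that by simp
  have \<pi>_base: "\<pi> b = \<one>\<^bsub>Q\<^esub>" if "b \<in> B" for b
    using that BN N.rcos_const[OF N.is_group] by (auto simp: \<pi>_def Q_def)
  have base_inv: "?i b \<in> B" if "b \<in> B" for b
    using subgroup.m_inv_closed[OF D(1) that] .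
  define comm where "comm g h \<longleftrightarrow> \<pi> g \<otimes>\<^bsub>Q\<^esub> \<pi> h = \<pi> h \<otimes>\<^bsub>Q\<^esub> \<pi> g" for g h
  have comm_comp: "comm f (g \<circ> h)" if "f \<in> G" "g \<in> G" "h \<in> G" "comm f g" "comm f h" for f g h
    using that \<pi>_carrier[of f] \<pi>_carrier[of g] \<pi>_carrier[of h]
    unfolding comm_def \<pi>_comp[OF that(2,3)] by (metis Q.m_assoc)
  have comm_sym: "comm f g \<Longrightarrow> comm g f" for f g
    by (simp add: comm_def)
  have distinct: "comm g h"
    if g: "g \<in> G" "sing X B g \<subseteq> {p}" and h: "h \<in> G" "sing X B h \<subseteq> {q}"
      and pq: "p \<noteq> q" "p \<in> topspace X" "q \<in> topspace X" for g h p q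
  proof -
    \<comment> \<open>Cancelling the germ of \<open>g\<close> at \<open>q\<close> by an element of \<open>B\<close> makes it trivial there.\<close>
    have normalize: "\<exists>u\<in>G. sing X B u \<subseteq> {p} \<and> agree_near X q u id \<and> \<pi> u = \<pi> g"
      if g: "g \<in> G" "sing X B g \<subseteq> {p}" and pq: "p \<noteq> q" "q \<in> topspace X" for g p q
    proof -
      have "q \<notin> sing X B g"
        using g pq by blast
      then obtain b where b: "b \<in> B" "agree_near X q g b"
        using pq by (auto simp: sing_iff regular_at_def)
      have bH: "b \<in> carrier (Homeo X)"
        using b D(3) GH by blast
      have "agree_near X q (?i b \<circ> g) (?i b \<circ> b)"
        using Homeo_in_topspace[OF GH[OF g(1)]] pq
        by (intro agree_near_comp[OF bH b(2)] agree_near_refl) simp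
      moreover have "?i b \<circ> b = id"
        using bH by (simp add: fun_eq_iff Homeo_inv_apply)
      moreover have "sing X B (?i b \<circ> g) \<subseteq> {p}"
        using sing_base_comp[OF D(1) base_inv[OF b(1)] GH[OF g(1)]] g(2) by blast
      moreover have "\<pi> (?i b \<circ> g) = \<pi> g"
        using \<pi>_comp[of "?i b" g] \<pi>_base[OF base_inv[OF b(1)]] base_inv[OF b(1)] D(3) g(1)
          \<pi>_carrier[OF g(1)] by (simp add: subset_iff)
      moreover have "?i b \<circ> g \<in> G"
        using compG[OF _ g(1)] base_inv[OF b(1)] D(3) by blast
      ultimately show ?thesis
        by auto
    qed
    obtain u where u: "u \<in> G" "sing X B u \<subseteq> {p}" "agree_near X q u id" "\<pi> u = \<pi> g"
      using normalize[OF g pq(1) pq(3)] by blast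
    obtain v where v: "v \<in> G" "sing X B v \<subseteq> {q}" "agree_near X p v id" "\<pi> v = \<pi> h"
      using normalize[OF h pq(1)[symmetric] pq(2)] by blast
    let ?w = "u \<circ> (v \<circ> (?i u \<circ> ?i v))"
    have w: "?w \<in> B"
      using commutator_mem_base[OF fge u(1,2) v(1,2) pq(1) u(3) v(3)] .
    have "u \<circ> v = ?w \<circ> (v \<circ> u)"
      using u v by (simp add: fun_eq_iff Homeo_inv_apply[OF GH])
    then have "\<pi> (u \<circ> v) = \<pi> ?w \<otimes>\<^bsub>Q\<^esub> \<pi> (v \<circ> u)"
      using \<pi>_comp[of ?w "v \<circ> u"] w D(3) compG[OF v(1) u(1)] by auto
    then have "\<pi> (u \<circ> v) = \<pi> (v \<circ> u)"
      using \<pi>_base[OF w] \<pi>_carrier[OF compG[OF v(1) u(1)]] by simp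
    then show ?thesis
      using \<pi>_comp[OF u(1) v(1)] \<pi>_comp[OF v(1) u(1)] u(4) v(4) by (simp add: comm_def)
  qed
  have comm_one_point: "comm g h"
    if g: "g \<in> G" "sing X B g \<subseteq> {p}" "p \<in> topspace X"
      and h: "h \<in> G" "sing X B h \<subseteq> {q}" "q \<in> topspace X" for g h p q
  proof (cases "p = q")
    case False
    then show ?thesis
      using distinct g h by blast
  next
    case True
    \<comment> \<open>Conjugating \<open>h\<close> by an element of \<open>B\<close> moves its singular point without changing its class.\<close>
    obtain b where b: "b \<in> B" "b q \<noteq> q"
      using no_fix h(3) by blast
    let ?k = "b \<circ> (h \<circ> ?i b)"
    have bG: "b \<in> G" "?i b \<in> G"
      using b base_inv D(3) by auto
    have k: "?k \<in> G"
      by (intro compG bG h(1))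
    have "sing X B ?k \<subseteq> {b q}"
      using sing_conj_base[OF D(1) b(1) GH[OF h(1)]] h(2) by blast
    then have "comm g ?k"
      using distinct[OF g(1,2) k, of "b q"] True b(2) g(3) h(3) Homeo_in_topspace[OF GH[OF bG(1)]]
      by auto
    moreover have "\<pi> ?k = \<pi> h"
      using \<pi>_comp[OF bG(1) compG[OF h(1) bG(2)]] \<pi>_comp[OF h(1) bG(2)]
        \<pi>_base[OF b(1)] \<pi>_base[OF base_inv[OF b(1)]] \<pi>_carrier[OF h(1)] by simp
    ultimately show ?thesis
      by (simp add: comm_def)
  qed
  have half: "comm g h"
    if g: "g \<in> G" "sing X B g \<subseteq> {p}" "p \<in> topspace X" and "h \<in> G" for g h p
    using fge \<open>h \<in> G\<close>
  proof (induction rule: finite_germ_extension_induct)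
    case (one_point h q)
    then show ?case using comm_one_point g by blast
  next
    case (comp h k)
    then show ?case using comm_comp g by blast
  qed (rule nonempty)
  have all: "comm h g" if "g \<in> G" "h \<in> G" for g h
    using fge \<open>g \<in> G\<close>
  proof (induction rule: finite_germ_extension_induct)
    case (one_point g p)
    then show ?case using half comm_sym \<open>h \<in> G\<close> by blast
  next
    case (comp g k)
    then show ?case using comm_comp \<open>h \<in> G\<close> by blast
  qed (rule nonempty)
  have "comm_group Q"
  proof (rule Q.group_comm_groupI)
    fix x y assume "x \<in> carrier Q" "y \<in> carrier Q"
    then obtain g h where "g \<in> G" "x = \<pi> g" "h \<in> G" "y = \<pi> h"
      unfolding Q_def carrier_FactGroup \<pi>_def by auto
    then show "x \<otimes>\<^bsub>Q\<^esub> y = y \<otimes>\<^bsub>Q\<^esub> x"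
      using all by (simp add: comm_def)
  qed
  then show ?thesis
    by (simp add: Q_def)
qed

section \<open>The commutator subgroup\<close>

lemma (in group) derived_le_if_comm_Mod:
  assumes N: "N \<lhd> G" and comm: "comm_group (G Mod N)"
  shows "derived G (carrier G) \<subseteq> N"
proof -
  interpret N: normal N G by (rule N)
  interpret Q: comm_group "G Mod N" by (rule comm)
  have "a \<otimes> b \<otimes> inv a \<otimes> inv b \<in> N" if a: "a \<in> carrier G" and b: "b \<in> carrier G" for a b
  proof -
    have "N #> (a \<otimes> b) = N #> (b \<otimes> a)"
      using Q.m_comm[of "N #> a" "N #> b"] a b
      by (auto simp: carrier_FactGroup N.rcos_sum)
    then have "a \<otimes> b \<otimes> inv (b \<otimes> a) \<in> N"
      using a b N.rcos_module_imp[of "b \<otimes> a" "a \<otimes> b"] rcos_self[of "a \<otimes> b" N] N.subgroup_axioms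
      by (simp add: is_group)
    then show ?thesis
      using a b by (simp add: inv_mult_group m_assoc)
  qed
  then show ?thesis
    unfolding derived_def by (intro generate_subgroup_incl N.subgroup_axioms) auto
qed

lemma (in group) normal_core:
  assumes K: "subgroup K G"
  shows "{k \<in> carrier G. \<forall>g\<in>carrier G. g \<otimes> k \<otimes> inv g \<in> K} \<lhd> G" (is "?M \<lhd> G")
proof (rule normal_invI)
  have "?M = (\<Inter>g\<in>carrier G. {x \<in> carrier G. g \<otimes> x \<otimes> inv g \<in> K})"
    by auto
  then show "subgroup ?M G"
    using subgroups_Inter[of "(\<lambda>g. {x \<in> carrier G. g \<otimes> x \<otimes> inv g \<in> K}) ` carrier G"]
      conjugate_preimage_subgroup[OF K] by auto
next
  fix x h assume x: "x \<in> carrier G" and h: "h \<in> ?M"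
  have "g \<otimes> (x \<otimes> h \<otimes> inv x) \<otimes> inv g \<in> K" if g: "g \<in> carrier G" for g
  proof -
    have "(g \<otimes> x) \<otimes> h \<otimes> inv (g \<otimes> x) \<in> K"
      using g x h by blast
    then show ?thesis
      using g x h by (simp add: m_assoc inv_mult_group)
  qed
  then show "x \<otimes> h \<otimes> inv x \<in> ?M"
    using x h by simp
qed

theorem theorem1p3:
  fixes X :: "'a topology" and B G :: "('a \<Rightarrow> 'a) set"
  assumes "Hausdorff_space X"
    and "finite_germ_extension X B G"
    and "is_simple (subgrp X B)"
    and "locally_moving X B"
    and "\<not> (\<exists>p\<in>topspace X. \<forall>b\<in>B. b p = p)"
    and "orbits (subgrp X B) (topspace X) (\<lambda>f. f) = orbits (subgrp X G) (topspace X) (\<lambda>f. f)"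
  shows "is_simple ((subgrp X G) \<lparr> carrier := derived (subgrp X G) G \<rparr>) \<and>
         (\<forall>N. N \<lhd> subgrp X G \<and> N \<noteq> {\<one>\<^bsub>subgrp X G\<^esub>} \<longrightarrow> comm_group (subgrp X G Mod N))"
proof -
  note X = assms(1) and fge = assms(2) and simple = assms(3) and lm = assms(4) and no_fix = assms(5)
  note D = finite_germ_extensionD[OF fge]
  interpret H: group "Homeo X" by (rule group_Homeo)
  interpret GG: group "subgrp X G" using D(2) by (rule H.subgroup_imp_group)
  let ?i = "m_inv (Homeo X)" and ?G' = "derived (subgrp X G) G"
  have GH: "f \<in> carrier (Homeo X)" if "f \<in> G" for f
    using subgroup.mem_carrier[OF D(2) that] .
  have invGG: "m_inv (subgrp X G) f = ?i f" if "f \<in> G" for f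
    using H.m_inv_consistent[OF D(2) that] .
  have invG: "?i f \<in> G" if "f \<in> G" for f
    using subgroup.m_inv_closed[OF D(2) that] .
  have nonempty: "topspace X \<noteq> {}"
  proof
    assume "topspace X = {}"
    then have "b = id" if "b \<in> B" for b
      using Homeo_outside[OF subgroup.mem_carrier[OF D(1) that]] by (auto simp: fun_eq_iff)
    then have "B = {id}"
      using subgroup.one_closed[OF D(1)] by auto
    then show False
      using simple by (simp add: is_simple_def)
  qed
  note absorbs = locally_moving_simple_le_normalized[OF X lm D(1) simple]
  have quotient: "comm_group (subgrp X G Mod N)"
    if N: "N \<lhd> subgrp X G" and nontriv: "N \<noteq> {id}" for N
  proof -
    have "subgroup N (Homeo X)"
      using H.incl_subgroup[OF D(2) normal_imp_subgroup[OF N]] .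
    moreover have "b \<circ> x \<circ> ?i b \<in> N" if "b \<in> B" "x \<in> N" for b x
      using GG.normal_invE(2)[OF N, of b x] that D(3) invGG by auto
    ultimately have "B \<subseteq> N"
      using absorbs nontriv by blast
    then show ?thesis
      using comm_group_Mod_base[OF fge no_fix nonempty N] by blast
  qed
  have G'_normal: "?G' \<lhd> subgrp X G"
    using GG.derived_self_is_normal by simp
  have G'_sub: "subgroup ?G' (subgrp X G)"
    using G'_normal by (rule normal_imp_subgroup)
  have G'G: "?G' \<subseteq> G"
    using subgroup.subset[OF G'_sub] by simp
  have G'_subH: "subgroup ?G' (Homeo X)"
    using H.incl_subgroup[OF D(2) G'_sub] .
  have conj_G': "g \<circ> x \<circ> ?i g \<in> ?G'" if "g \<in> G" "x \<in> ?G'" for g x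
    using GG.normal_invE(2)[OF G'_normal, of g x] that invGG by auto
  have G'_nontriv: "?G' \<noteq> {id}"
  proof -
    obtain b c where bc: "b \<in> B" "c \<in> B" "b \<circ> c \<noteq> c \<circ> b"
      by (rule locally_moving_noncommuting[OF X lm D(1) openin_topspace nonempty]) (rule that)
    then have bcG: "b \<in> G" "c \<in> G"
      using D(3) by auto
    then have "b \<circ> c \<circ> ?i b \<circ> ?i c \<in> derived_set (subgrp X G) G"
      using invGG by force
    then have "b \<circ> c \<circ> ?i b \<circ> ?i c \<in> ?G'"
      unfolding derived_def by (rule generate.incl)
    moreover have "b \<circ> c \<circ> ?i b \<circ> ?i c \<noteq> id"
      using H.commutator_one_iff[of b c] bc bcG GH by (simp add: comp_assoc)
    ultimately show ?thesis
      by blast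
  qed
  have BG': "B \<subseteq> ?G'"
    using absorbs[OF G'_subH G'_nontriv] conj_G' D(3) by blast
  have "K = ?G'" if K: "K \<lhd> (subgrp X G) \<lparr> carrier := ?G' \<rparr>" and nontriv: "K \<noteq> {id}" for K
  proof -
    interpret G': group "(subgrp X G) \<lparr> carrier := ?G' \<rparr>"
      using G'_sub by (rule GG.subgroup_imp_group)
    have K_G': "K \<subseteq> ?G'"
      using subgroup.subset[OF normal_imp_subgroup[OF K]] by simp
    have K_sub: "subgroup K (subgrp X G)"
      using GG.incl_subgroup[OF G'_sub normal_imp_subgroup[OF K]] .
    have K_subH: "subgroup K (Homeo X)"
      using H.incl_subgroup[OF D(2) K_sub] .
    have conj_K: "x \<circ> k \<circ> ?i x \<in> K" if "x \<in> ?G'" "k \<in> K" for x k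
      using G'.normal_invE(2)[OF K, of x k] that G'G
        GG.m_inv_consistent[OF G'_sub that(1)] invGG by auto
    \<comment> \<open>\<open>K\<close> is only normal in \<open>G'\<close>; its core is normal in \<open>G\<close> and still contains \<open>B\<close>.\<close>
    define M where "M = {k \<in> G. \<forall>g\<in>G. g \<circ> k \<circ> ?i g \<in> K}"
    have M: "M \<lhd> subgrp X G"
      using GG.normal_core[OF K_sub] by (simp add: M_def invGG cong: conj_cong)
    have "b \<in> M" if b: "b \<in> B" for b
    proof -
      have "g \<circ> b \<circ> ?i g \<in> K" if g: "g \<in> G" for g
        using locally_moving_simple_conj_le_normalized[OF X lm D(1) simple GH[OF g] K_subH nontriv _ b]
          conj_K conj_G'[OF g] BG' by blast
      then show ?thesis
        using b D(3) by (auto simp: M_def)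
    qed
    then have "comm_group (subgrp X G Mod M)"
      using comm_group_Mod_base[OF fge no_fix nonempty M] by blast
    then have "?G' \<subseteq> M"
      using GG.derived_le_if_comm_Mod[OF M] by simp
    moreover have "M \<subseteq> K"
    proof
      fix k assume "k \<in> M"
      then have "id \<circ> k \<circ> ?i id \<in> K"
        using subgroup.one_closed[OF D(2)] unfolding M_def by auto
      then show "k \<in> K"
        using H.inv_one by simp
    qed
    ultimately show ?thesis
      using K_G' by blast
  qed
  then have "is_simple ((subgrp X G) \<lparr> carrier := ?G' \<rparr>)"
    using GG.subgroup_imp_group[OF G'_sub] G'_nontriv unfolding is_simple_def by auto
  then show ?thesis
    using quotient by simp
qed

end
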